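(* Fix integers $d,n\geq 1$. Let \[D^{d+1}=\{(x_1,\dots, x_{d+1},0) : x_1^2+\dots+x_{d+1}^2\leq 1\}\subset \mathbb{R}^{d+2}\] and suppose $A_1,\dots, A_{n}\subset D^{d+1}$ are measurable sets. For $p\in \partial D^{d+1}=\{(x_1,\dots, x_{d+1},0) : x_1^2+\cdots+x_{d+1}^2 = 1\}$, let $H^+(p)$ and $H^-(p)$ denote the closed halfspaces of $\mathbb{R}^{d+2}$ determined by the inequalities $\langle x,p \rangle\geq 0$ and $\langle x,p \rangle\leq 0$, respectively. Then there exist numbers $0=t_0\leq t_1\leq \cdots \leq t_{k}\leq t_{k+1}=1$ with $k\le n$ and vectors $p_1,\dots,p_{k+1}\in\partial D^{d+1}$ such that (1) $\arccos(\langle p_i,p_j\rangle)\leq \pi-p_{n+1}(\mathbb{R}P^d)$ for all $i$ and $j$ (in particular, no two of the vectors are antipodal), and (2) the $n$ masses $A_j\times [0,1]$ are equipartitioned by taking $(A_j\times [t_{i-1},t_i])\cap H^+(p_i)$ for each $1\leq i \leq k+1$; that is, for each $1\le j\le n$, the sum over $1\le i\le k+1$ of the measures of $(A_j\times [t_{i-1},t_i])\cap H^+(p_i)$ equals the sum over $1\le i\le k+1$ of the measures of $(A_j\times [t_{i-1},t_i])\cap H^-(p_i)$.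
   Context: For $A\subset D^{d+1}$ and an interval $[s,t]\subset[0,1]$, $A\times[s,t]$ denotes the set of points $(x_1,\dots,x_{d+1},u)\in\mathbb{R}^{d+2}$ with $(x_1,\dots,x_{d+1},0)\in A$ and $u\in[s,t]$. Measurability of subsets of $D^{d+1}$ is with respect to $(d+1)$-dimensional Lebesgue measure, and the measure of subsets of $\mathbb{R}^{d+2}$ is Lebesgue measure. $\mathbb{R}P^d$ carries the metric in which the distance between two points is the angle in $[0,\pi/2]$ between the corresponding lines in $\mathbb{R}^{d+1}$. For a compact metric space $(X,d)$ and $m\ge 1$, $p_m(X)=\sup\{\varepsilon>0 : \text{there are } x_1,\dots,x_m\in X \text{ with } d(x_i,x_j)\ge\varepsilon \text{ for all } i\ne j\}$ (the number $p_{n+1}(\mathbb{R}P^d)$ is unrelated to the vectors $p_i$). *)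

theory Defs
  imports "HOL-Analysis.Analysis"
begin

text \<open>
  The space \<open>\<real>\<^bsup>d+2\<^esup>\<close> is rendered as \<open>(real ^ 'm) \<times> real\<close> with \<open>CARD('m) = d + 1\<close>: the first factor
  holds the coordinates \<open>x\<^sub>1, \<dots>, x\<^sub>d\<^sub>+\<^sub>1\<close> and the second one the last coordinate. The library's inner
  product and Lebesgue measure on the product type are the Euclidean ones. The definitions below
  work for any Euclidean space \<open>'a\<close> in place of \<open>real ^ 'm\<close>.
\<close>

definition flat_disc :: "('a::euclidean_space \<times> real) set"
  where "flat_disc = cball 0 1 \<times> {0}"

definition flat_disc_boundary :: "('a::euclidean_space \<times> real) set"
  where "flat_disc_boundary = sphere 0 1 \<times> {0}"

text \<open>
  Measurability with respect to Lebesgue measure on the hyperplane where the last coordinate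
  vanishes. (As a subset of the product space such a set is always a null set.)
\<close>

definition flat_measurable :: "('a::euclidean_space \<times> real) set \<Rightarrow> bool"
  where "flat_measurable A \<longleftrightarrow> {x. (x, 0) \<in> A} \<in> sets lebesgue"

definition cylinder :: "('a::euclidean_space \<times> real) set \<Rightarrow> real set \<Rightarrow> ('a \<times> real) set"
  where "cylinder A I = {(x, u). (x, 0) \<in> A \<and> u \<in> I}"

definition halfspace_pos :: "'a::real_inner \<Rightarrow> 'a set"
  where "halfspace_pos p = {x. inner x p \<ge> 0}"

definition halfspace_neg :: "'a::real_inner \<Rightarrow> 'a set"
  where "halfspace_neg p = {x. inner x p \<le> 0}"

text \<open>
  The points of the projective space are the lines through the origin, so that
  \<open>\<real>P\<^bsup>d\<^esup>\<close> is \<open>projective_space :: (real ^ 'm) set set\<close> with \<open>CARD('m) = d + 1\<close>.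
\<close>

definition projective_space :: "'a::euclidean_space set set"
  where "projective_space = {L. subspace L \<and> dim L = 1}"

definition line_angle :: "'a::euclidean_space set \<Rightarrow> 'a set \<Rightarrow> real"
  where "line_angle L M =
    (THE \<theta>. 0 \<le> \<theta> \<and> \<theta> \<le> pi / 2 \<and>
       (\<exists>x\<in>L. \<exists>y\<in>M. norm x = 1 \<and> norm y = 1 \<and> inner x y = cos \<theta>))"

lemma unit_vector_in_span:
  fixes x v :: "'a::euclidean_space"
  assumes "norm x = 1" "norm v = 1" "v \<in> span {x}"
  shows "v = x \<or> v = - x"
proof -
  obtain c where c: "v = c *\<^sub>R x" using assms(3) by (auto simp: span_singleton)
  then have "\<bar>c\<bar> = 1" using assms by simp
  then show ?thesis using c by (auto simp: abs_if split: if_splits)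
qed

lemma line_angle_span:
  fixes x y :: "'a::euclidean_space"
  assumes "norm x = 1" "norm y = 1"
  shows "line_angle (span {x}) (span {y}) = arccos \<bar>inner x y\<bar>"
  unfolding line_angle_def
proof (rule the_equality)
  have le: "\<bar>inner x y\<bar> \<le> 1" using Cauchy_Schwarz_ineq2[of x y] assms by simp
  have rng: "0 \<le> arccos \<bar>inner x y\<bar>" "arccos \<bar>inner x y\<bar> \<le> pi / 2"
    using le arccos_lbound[of "\<bar>inner x y\<bar>"] arccos_le_arccos[of 0 "\<bar>inner x y\<bar>"] by auto
  have cs: "cos (arccos \<bar>inner x y\<bar>) = \<bar>inner x y\<bar>" using le by (simp add: cos_arccos)
  define s where "s = (if inner x y \<ge> 0 then x else - x)"
  have "s \<in> span {x}" by (auto simp: s_def span_base span_neg)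
  moreover have "y \<in> span {y}" by (simp add: span_base)
  moreover have "norm s = 1" "inner s y = \<bar>inner x y\<bar>" using assms by (auto simp: s_def)
  ultimately show "0 \<le> arccos \<bar>inner x y\<bar> \<and> arccos \<bar>inner x y\<bar> \<le> pi / 2 \<and>
      (\<exists>u\<in>span {x}. \<exists>v\<in>span {y}. norm u = 1 \<and> norm v = 1 \<and>
         inner u v = cos (arccos \<bar>inner x y\<bar>))"
    using rng cs assms by metis
next
  fix \<theta>
  assume a: "0 \<le> \<theta> \<and> \<theta> \<le> pi / 2 \<and>
      (\<exists>u\<in>span {x}. \<exists>v\<in>span {y}. norm u = 1 \<and> norm v = 1 \<and> inner u v = cos \<theta>)"
  then obtain u v where uv: "u \<in> span {x}" "v \<in> span {y}" "norm u = 1" "norm v = 1"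
    "inner u v = cos \<theta>" by blast
  have "u = x \<or> u = - x" "v = y \<or> v = - y"
    using unit_vector_in_span uv assms by blast+
  then have "\<bar>inner u v\<bar> = \<bar>inner x y\<bar>" by auto
  moreover have "cos \<theta> \<ge> 0" using a by (intro cos_ge_zero) auto
  ultimately have "cos \<theta> = \<bar>inner x y\<bar>" using uv(5) by simp
  then show "\<theta> = arccos \<bar>inner x y\<bar>" using a arccos_cos[of \<theta>] pi_gt_zero by simp
qed

text \<open>
  The number \<open>p\<^sub>m(X)\<close> of a compact metric space with carrier \<open>X\<close> and distance function \<open>\<delta>\<close>.
  The supremum is over an unbounded set when \<open>m = 1\<close>; only \<open>m \<ge> 2\<close> is meaningful here.
\<close>

definition packing_distance :: "nat \<Rightarrow> 'b set \<Rightarrow> ('b \<Rightarrow> 'b \<Rightarrow> real) \<Rightarrow> real"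
  where "packing_distance m X \<delta> =
    Sup {\<epsilon>. \<epsilon> > 0 \<and> (\<exists>x :: nat \<Rightarrow> 'b. (\<forall>i\<in>{1..m}. x i \<in> X) \<and>
               (\<forall>i\<in>{1..m}. \<forall>j\<in>{1..m}. i \<noteq> j \<longrightarrow> \<delta> (x i) (x j) \<ge> \<epsilon>))}"

end

theory Submission
  imports Defs
begin

text \<open>
  For a unit vector \<open>v\<close> let \<open>f\<^sub>j v\<close> be the measure of the part of \<open>A\<^sub>j\<close> on the positive side of
  the hyperplane orthogonal to \<open>v\<close> minus the measure of the part on the negative side. Cutting a
  slab of \<open>A\<^sub>j \<times> [0,1]\<close> of height \<open>w\<close> by the halfspaces of \<open>v\<close> contributes \<open>w * f\<^sub>j v\<close> to the
  imbalance, so the theorem asks for unit vectors \<open>p\<^sub>i\<close> and weights \<open>w\<^sub>i \<ge> 0\<close> with sum 1 such that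
  \<open>\<Sum>\<^sub>i w\<^sub>i * f\<^sub>j p\<^sub>i = 0\<close> for all \<open>j\<close>; the \<open>t\<^sub>i\<close> are then the partial sums of the weights.

  Let \<open>E\<close> be the packing distance of \<open>n + 1\<close> points in the projective space, and take unit vectors
  \<open>x\<^sub>1, \<dots>, x\<^sub>n\<^sub>+\<^sub>1\<close> that span lines at pairwise angles at least \<open>E\<close>; by compactness they exist
  (\<open>optimal_separated_lines\<close>). However the signs are chosen, the vectors \<open>\<plusminus>x\<^sub>i\<close> have pairwise
  angles at most \<open>\<pi> - E\<close> (\<open>arccos_signed_separated_lines\<close>). So it suffices to find signs and
  weights. The simplices spanned by all sign choices form the boundary of a cross-polytope, which
  is a sphere of dimension \<open>n\<close>, and the affine extension of \<open>f\<close> to it is an odd map to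
  \<open>\<real>\<^sup>n\<close>. A zero of such a map would in general come from the Borsuk-Ulam theorem, but oddness of
  \<open>f\<close> makes this map the restriction of the linear map sending the \<open>i\<close>-th basis vector of
  \<open>\<real>\<^bsup>n+1\<^esup>\<close> to \<open>f x\<^sub>i\<close>, so that a nonzero kernel vector is enough: its signs are the
  signs of the \<open>x\<^sub>i\<close>, and its absolute values, normalized, are the weights
  (\<open>odd_functions_common_signed_zero\<close>).
\<close>

section \<open>Odd maps and signed points\<close>

text \<open>
  Gaussian elimination: an equation with a nonzero coefficient is used to eliminate one unknown
  from all the others, which leaves one equation and one unknown less.
\<close>

lemma homogeneous_system_solvable:
  fixes a :: "'j \<Rightarrow> 'i \<Rightarrow> 'k::field"
  assumes "finite J" "finite I" "card J < card I"
  shows "\<exists>c. (\<exists>i\<in>I. c i \<noteq> 0) \<and> (\<forall>j\<in>J. (\<Sum>i\<in>I. c i * a j i) = 0)"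
  using assms
proof (induction J arbitrary: I a rule: finite_induct)
  case empty
  then have "I \<noteq> {}" by auto
  then show ?case by (intro exI[of _ "\<lambda>_. 1"]) auto
next
  case (insert j J)
  show ?case
  proof (cases "\<forall>i\<in>I. a j i = 0")
    case True
    have "card J < card I" using insert by simp
    from insert.IH[OF \<open>finite I\<close> this, of a] show ?thesis using True by auto
  next
    case False
    then obtain h where h: "h \<in> I" "a j h \<noteq> 0" by blast
    define b where "b l i = a l i - a l h / a j h * a j i" for l i
    have "card J < card (I - {h})" using insert h by simp
    from insert.IH[OF _ this, of b] insert.prems obtain c where
      c: "\<exists>i\<in>I - {h}. c i \<noteq> 0" "\<And>l. l \<in> J \<Longrightarrow> (\<Sum>i\<in>I - {h}. c i * b l i) = 0"
      by auto
    \<comment> \<open>The value at the pivot is the one that solves equation \<open>j\<close>.\<close>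
    define c' where "c' = c(h := - (\<Sum>i\<in>I - {h}. c i * a j i) / a j h)"
    have split: "(\<Sum>i\<in>I. c' i * a l i) = c' h * a l h + (\<Sum>i\<in>I - {h}. c i * a l i)" for l
      using insert.prems h by (subst sum.remove[of _ h]) (auto simp: c'_def intro!: sum.cong)
    have "(\<Sum>i\<in>I. c' i * a j i) = 0"
      unfolding split using h by (simp add: c'_def)
    moreover have "(\<Sum>i\<in>I. c' i * a l i) = 0" if "l \<in> J" for l
    proof -
      have "0 = (\<Sum>i\<in>I - {h}. c i * a l i) - a l h / a j h * (\<Sum>i\<in>I - {h}. c i * a j i)"
        using c(2)[OF that]
        by (simp add: b_def algebra_simps sum_subtractf sum_distrib_left sum_divide_distrib)
      then show ?thesis unfolding split using h by (simp add: c'_def field_simps)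
    qed
    ultimately show ?thesis using c(1) by (intro exI[of _ c']) (auto simp: c'_def)
  qed
qed

text \<open>
  The coefficients of a nontrivial linear relation among the vectors \<open>f (x i)\<close> may have any sign.
  Oddness moves the sign of each coefficient into the argument, and what is left are nonnegative
  coefficients with a positive sum.
\<close>

lemma odd_functions_common_signed_zero:
  fixes f :: "'j \<Rightarrow> 'v::group_add \<Rightarrow> real" and x :: "'i \<Rightarrow> 'v"
  assumes fin: "finite J" "finite I" and less: "card J < card I"
    and odd: "\<And>j v. j \<in> J \<Longrightarrow> f j (- v) = - f j v"
  obtains w p where "\<And>i. i \<in> I \<Longrightarrow> w i \<ge> 0" "(\<Sum>i\<in>I. w i) = 1"
    "\<And>i. i \<in> I \<Longrightarrow> p i = x i \<or> p i = - x i"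
    "\<And>j. j \<in> J \<Longrightarrow> (\<Sum>i\<in>I. w i * f j (p i)) = 0"
proof -
  obtain c :: "'i \<Rightarrow> real" where c: "\<exists>i\<in>I. c i \<noteq> 0"
      "\<And>j. j \<in> J \<Longrightarrow> (\<Sum>i\<in>I. c i * f j (x i)) = 0"
    using homogeneous_system_solvable[OF fin less, of "\<lambda>j i. f j (x i)"] by blast
  define C where "C = (\<Sum>i\<in>I. \<bar>c i\<bar>)"
  have "C > 0" unfolding C_def using c(1) fin by (auto intro: sum_pos2)
  define p where "p i = (if c i < 0 then - x i else x i)" for i
  have "(\<Sum>i\<in>I. \<bar>c i\<bar> / C * f j (p i)) = 0" if "j \<in> J" for j
  proof -
    have "(\<Sum>i\<in>I. \<bar>c i\<bar> / C * f j (p i)) = (\<Sum>i\<in>I. c i * f j (x i)) / C"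
      unfolding sum_divide_distrib by (intro sum.cong) (auto simp: p_def odd[OF that])
    then show ?thesis using c(2)[OF that] by simp
  qed
  moreover have "(\<Sum>i\<in>I. \<bar>c i\<bar> / C) = 1"
    using \<open>C > 0\<close> by (simp add: sum_divide_distrib[symmetric] C_def)
  ultimately show ?thesis
    using that[of "\<lambda>i. \<bar>c i\<bar> / C" p] \<open>C > 0\<close> by (auto simp: p_def)
qed

section \<open>Optimal packings of lines\<close>

lemma projective_space_iff:
  "L \<in> projective_space \<longleftrightarrow> (\<exists>x. norm x = 1 \<and> L = span {x :: 'a::euclidean_space})"
proof
  assume "L \<in> projective_space"
  then have L: "subspace L" "dim L = 1" by (auto simp: projective_space_def)
  obtain B where B: "B \<subseteq> L" "independent B" "span B = L" "card B = 1"
    using basis_exists[of L] L by (metis span_subspace)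
  then obtain b where b: "B = {b}" by (auto simp: card_1_singleton_iff)
  then have "b \<noteq> 0" using B by auto
  then have "span {(1 / norm b) *\<^sub>R b} = span {b}"
    by (intro span_image_scale[of "{b}" "\<lambda>_. 1 / norm b", simplified]) auto
  then show "\<exists>x. norm x = 1 \<and> L = span {x}"
    using B b \<open>b \<noteq> 0\<close> by (intro exI[of _ "(1 / norm b) *\<^sub>R b"]) auto
next
  assume "\<exists>x. norm x = 1 \<and> L = span {x}"
  then obtain x where x: "norm x = 1" "L = span {x}" by blast
  then have "independent {x}" by auto
  then have "dim {x} = 1" by (subst dim_eq_card_independent) auto
  with x show "L \<in> projective_space" by (auto simp: projective_space_def)
qed

text \<open>
  Lines are given by unit vectors, of which only those with index in \<open>{1..m}\<close>
  matter. Demanding norm 1 at every index makes the configurations closed subsets of a product of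
  spheres over all indices, which is compact by Tychonoff's theorem.
\<close>

definition separated_lines :: "nat \<Rightarrow> real \<Rightarrow> (nat \<Rightarrow> 'a::euclidean_space) \<Rightarrow> bool"
  where "separated_lines m \<epsilon> x \<longleftrightarrow> (\<forall>i. norm (x i) = 1) \<and>
    (\<forall>i\<in>{1..m}. \<forall>j\<in>{1..m}. i \<noteq> j \<longrightarrow> \<epsilon> \<le> arccos \<bar>inner (x i) (x j)\<bar>)"

lemma separated_lines_mono: "separated_lines m \<delta> x \<Longrightarrow> \<epsilon> \<le> \<delta> \<Longrightarrow> separated_lines m \<epsilon> x"
  by (fastforce simp: separated_lines_def)

lemma packing_distance_projective_space:
  "packing_distance m (projective_space :: 'a::euclidean_space set set) line_angle =
   Sup {\<epsilon>. \<epsilon> > 0 \<and> (\<exists>x :: nat \<Rightarrow> 'a. separated_lines m \<epsilon> x)}"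
proof -
  have "(\<exists>L :: nat \<Rightarrow> 'a set. (\<forall>i\<in>{1..m}. L i \<in> projective_space) \<and>
           (\<forall>i\<in>{1..m}. \<forall>j\<in>{1..m}. i \<noteq> j \<longrightarrow> line_angle (L i) (L j) \<ge> \<epsilon>)) \<longleftrightarrow>
        (\<exists>x :: nat \<Rightarrow> 'a. separated_lines m \<epsilon> x)" (is "?l \<longleftrightarrow> ?r") for \<epsilon>
  proof
    assume ?l
    then obtain L :: "nat \<Rightarrow> 'a set" where L: "\<forall>i\<in>{1..m}. L i \<in> projective_space"
      "\<forall>i\<in>{1..m}. \<forall>j\<in>{1..m}. i \<noteq> j \<longrightarrow> line_angle (L i) (L j) \<ge> \<epsilon>" by blast
    have "\<exists>x. norm x = 1 \<and> (i \<in> {1..m} \<longrightarrow> L i = span {x})" for i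
      using L(1) projective_space_iff vector_choose_size[of 1] by (metis zero_le_one)
    then obtain x where "\<And>i. norm (x i) = 1" "\<And>i. i \<in> {1..m} \<Longrightarrow> L i = span {x i}" by metis
    with L(2) show ?r by (auto simp: separated_lines_def line_angle_span intro!: exI[of _ x])
  next
    assume ?r
    then obtain x :: "nat \<Rightarrow> 'a" where "separated_lines m \<epsilon> x" by blast
    then show ?l by (intro exI[of _ "\<lambda>i. span {x i}"])
        (auto simp: separated_lines_def line_angle_span projective_space_iff)
  qed
  then show ?thesis by (simp add: packing_distance_def)
qed

lemma separated_lines_le_pi_half:
  assumes "separated_lines m \<epsilon> x" "m \<ge> 2"
  shows "\<epsilon> \<le> pi / 2"
proof -
  have "\<bar>inner (x 1) (x 2)\<bar> \<le> 1"
    using assms Cauchy_Schwarz_ineq2[of "x 1" "x 2"] by (simp add: separated_lines_def)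
  then have "arccos \<bar>inner (x 1) (x 2)\<bar> \<le> pi / 2"
    using arccos_le_arccos[of 0 "\<bar>inner (x 1) (x 2)\<bar>"] by simp
  moreover have "\<epsilon> \<le> arccos \<bar>inner (x 1) (x 2)\<bar>"
    using assms by (auto simp: separated_lines_def)
  ultimately show ?thesis by linarith
qed

text \<open>
  In dimension at least 2 there are infinitely many lines. This keeps the supremum that defines
  the packing distance away from the empty set.
\<close>

lemma separated_lines_exist:
  assumes "DIM('a::euclidean_space) \<ge> 2"
  shows "\<exists>\<epsilon>>0. \<exists>x :: nat \<Rightarrow> 'a. separated_lines m \<epsilon> x"
proof -
  obtain e f :: 'a where ef: "e \<in> Basis" "f \<in> Basis" "e \<noteq> f"
  proof -
    obtain T :: "'a set" where T: "T \<subseteq> Basis" "card T = 2"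
      using assms by (rule obtain_subset_with_card_n)
    then show ?thesis using that by (auto simp: card_2_iff)
  qed
  \<comment> \<open>The vectors \<open>e + i f\<close> have pairwise different slopes, so no two are parallel.\<close>
  define y where "y i = e + real i *\<^sub>R f" for i
  define x where "x i = y i /\<^sub>R norm (y i)" for i
  have ye: "inner (y i) e = 1" "inner (y i) f = real i" for i
    using ef by (auto simp: y_def inner_simps inner_Basis)
  then have y0: "y i \<noteq> 0" for i by (metis inner_zero_left zero_neq_one)
  have x1: "norm (x i) = 1" for i using y0 by (simp add: x_def)
  have pos: "0 < arccos \<bar>inner (x i) (x j)\<bar>" if "i \<noteq> j" for i j
  proof -
    have "\<bar>inner (x i) (x j)\<bar> \<noteq> 1"
    proof
      \<comment> \<open>Equality in the Cauchy-Schwarz inequality forces \<open>y i\<close> and \<open>y j\<close> to be parallel.\<close>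
      assume "\<bar>inner (x i) (x j)\<bar> = 1"
      then have "\<bar>inner (y i) (y j)\<bar> = norm (y i) * norm (y j)"
        using y0[of i] y0[of j] by (simp add: x_def abs_mult field_simps)
      then consider "norm (y i) *\<^sub>R y j = norm (y j) *\<^sub>R y i"
        | "norm (y i) *\<^sub>R y j = - norm (y j) *\<^sub>R y i"
        using norm_cauchy_schwarz_abs_eq[of "y i" "y j"] by auto
      then obtain a b where ab: "a *\<^sub>R y j = b *\<^sub>R y i" "a \<noteq> 0"
        using y0[of i] by (metis norm_eq_zero)
      from arg_cong[OF ab(1), of "\<lambda>v. inner v e"] have "a = b" by (simp add: ye)
      with arg_cong[OF ab(1), of "\<lambda>v. inner v f"] ab(2) that show False by (simp add: ye)
    qed
    moreover have "\<bar>inner (x i) (x j)\<bar> \<le> 1"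
      using Cauchy_Schwarz_ineq2[of "x i" "x j"] x1 by simp
    ultimately show ?thesis using arccos_less_arccos[of "\<bar>inner (x i) (x j)\<bar>" 1] by simp
  qed
  define P where "P = {(i, j). i \<in> {1..m} \<and> j \<in> {1..m} \<and> i \<noteq> j}"
  have fin: "finite P" by (rule finite_subset[of _ "{1..m} \<times> {1..m}"]) (auto simp: P_def)
  \<comment> \<open>The element 1 makes the set nonempty when \<open>m < 2\<close>.\<close>
  define \<epsilon> where "\<epsilon> = Min (insert 1 ((\<lambda>(i, j). arccos \<bar>inner (x i) (x j)\<bar>) ` P))"
  have "\<epsilon> > 0" unfolding \<epsilon>_def using fin pos by (subst Min_gr_iff) (auto simp: P_def)
  moreover have "\<epsilon> \<le> arccos \<bar>inner (x i) (x j)\<bar>"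
    if "i \<in> {1..m}" "j \<in> {1..m}" "i \<noteq> j" for i j
    unfolding \<epsilon>_def using fin that by (intro Min_le) (auto simp: P_def)
  ultimately show ?thesis
    using x1 by (intro exI[of _ \<epsilon>] conjI exI[of _ x]) (auto simp: separated_lines_def)
qed

lemma compact_sphere_functions:
  "compact {x :: nat \<Rightarrow> 'a::euclidean_space. \<forall>i. norm (x i) = 1}"
proof -
  have "compactin (product_topology (\<lambda>_. euclidean) UNIV) (PiE UNIV (\<lambda>_ :: nat. sphere (0::'a) 1))"
    by (simp add: compactin_PiE)
  moreover have "PiE UNIV (\<lambda>_ :: nat. sphere (0::'a) 1) = {x. \<forall>i. norm (x i) = 1}"
    by (auto simp: PiE_def)
  ultimately show ?thesis by (simp add: euclidean_product_topology)
qed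

text \<open>
  The supremum is attained: the sets of configurations that are \<open>\<epsilon>\<close>-separated, for \<open>\<epsilon>\<close> below the
  supremum, are closed in a compact space and decrease with \<open>\<epsilon>\<close>, so they have a common element.
\<close>

lemma optimal_separated_lines:
  assumes dim: "DIM('a::euclidean_space) \<ge> 2" and "m \<ge> 2"
  defines "E \<equiv> packing_distance m (projective_space :: 'a::euclidean_space set set) line_angle"
  obtains x :: "nat \<Rightarrow> 'a::euclidean_space" where "separated_lines m E x" "E > 0"
proof -
  define S where "S = {\<epsilon>. \<epsilon> > 0 \<and> (\<exists>x :: nat \<Rightarrow> 'a. separated_lines m \<epsilon> x)}"
  have E: "E = Sup S" by (simp add: E_def S_def packing_distance_projective_space)
  obtain \<epsilon>0 where \<epsilon>0: "\<epsilon>0 \<in> S" using separated_lines_exist[OF dim, of m] by (auto simp: S_def)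
  have bdd: "bdd_above S"
    using separated_lines_le_pi_half \<open>m \<ge> 2\<close> by (intro bdd_aboveI[of _ "pi / 2"]) (auto simp: S_def)
  \<comment> \<open>The separation is expressed by cosines, because the inner product is continuous everywhere,
    whereas \<open>arccos\<close> is so only on the interval from -1 to 1.\<close>
  let ?K = "{x :: nat \<Rightarrow> 'a. \<forall>i. norm (x i) = 1}"
  let ?C = "\<lambda>\<epsilon>. {x :: nat \<Rightarrow> 'a. \<forall>i\<in>{1..m}. \<forall>j\<in>{1..m}. i \<noteq> j \<longrightarrow> \<bar>inner (x i) (x j)\<bar> \<le> cos \<epsilon>}"
  have sep_iff: "separated_lines m \<epsilon> x \<longleftrightarrow> x \<in> ?K \<inter> ?C \<epsilon>" if "\<epsilon> \<in> S" for \<epsilon> x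
  proof -
    obtain z :: "nat \<Rightarrow> 'a" where "0 \<le> \<epsilon>" "separated_lines m \<epsilon> z"
      using \<open>\<epsilon> \<in> S\<close> by (auto simp: S_def)
    moreover from this have "\<epsilon> \<le> pi"
      using separated_lines_le_pi_half[of m \<epsilon> z] \<open>m \<ge> 2\<close> pi_gt_zero by linarith
    ultimately have "arccos (cos \<epsilon>) = \<epsilon>" by (simp add: arccos_cos)
    moreover have "\<bar>inner (x i) (x j)\<bar> \<le> 1" if "x \<in> ?K" for i j
      using Cauchy_Schwarz_ineq2[of "x i" "x j"] that by simp
    ultimately have "\<epsilon> \<le> arccos \<bar>inner (x i) (x j)\<bar> \<longleftrightarrow> \<bar>inner (x i) (x j)\<bar> \<le> cos \<epsilon>"
      if "x \<in> ?K" for i j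
      using arccos_le_mono[of "cos \<epsilon>" "\<bar>inner (x i) (x j)\<bar>"] that by simp
    then show ?thesis by (auto simp: separated_lines_def)
  qed
  have "?K \<inter> (\<Inter>\<epsilon>\<in>S. ?C \<epsilon>) \<noteq> {}"
  proof (rule compact_imp_fip_image[OF compact_sphere_functions])
    fix \<epsilon>
    show "closed (?C \<epsilon>)"
      unfolding Ball_def
      by (intro closed_Collect_all closed_Collect_imp closed_Collect_le open_Collect_const
          continuous_intros continuous_on_product_coordinates)
  next
    fix T assume T: "finite T" "T \<subseteq> S"
    \<comment> \<open>The most demanding separation in \<open>T\<close>; adding \<open>\<epsilon>0\<close> covers the case that \<open>T\<close> is empty.\<close>
    define \<mu> where "\<mu> = Max (insert \<epsilon>0 T)"
    have "\<mu> \<in> S" unfolding \<mu>_def using T \<epsilon>0 Max_in[of "insert \<epsilon>0 T"] by auto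
    then obtain x :: "nat \<Rightarrow> 'a" where x: "separated_lines m \<mu> x" by (auto simp: S_def)
    have "\<epsilon> \<le> \<mu>" if "\<epsilon> \<in> T" for \<epsilon> using T that by (simp add: \<mu>_def)
    then have "x \<in> ?K \<inter> ?C \<epsilon>" if "\<epsilon> \<in> T" for \<epsilon>
      using separated_lines_mono[OF x] sep_iff T that by blast
    moreover have "x \<in> ?K" using x by (simp add: separated_lines_def)
    ultimately show "?K \<inter> (\<Inter>\<epsilon>\<in>T. ?C \<epsilon>) \<noteq> {}" by blast
  qed
  then obtain x where "x \<in> ?K \<inter> (\<Inter>\<epsilon>\<in>S. ?C \<epsilon>)" by blast
  then have x: "separated_lines m \<epsilon> x" if "\<epsilon> \<in> S" for \<epsilon> using sep_iff[OF that] that by blast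
  have "separated_lines m E x"
    unfolding separated_lines_def E
  proof (intro conjI allI ballI impI)
    show "norm (x i) = 1" for i using x[OF \<epsilon>0] by (simp add: separated_lines_def)
  next
    fix i j assume "i \<in> {1..m}" "j \<in> {1..m}" "i \<noteq> j"
    then show "Sup S \<le> arccos \<bar>inner (x i) (x j)\<bar>"
      using x \<epsilon>0 by (intro cSup_least) (auto simp: separated_lines_def)
  qed
  moreover have "E > 0" using cSup_upper[OF \<epsilon>0 bdd] \<epsilon>0 by (auto simp: E S_def)
  ultimately show ?thesis using that by blast
qed

text \<open>
  If two lines meet at an angle \<open>\<theta> \<le> \<pi>/2\<close>, then any two direction vectors enclose the angle \<open>\<theta>\<close> or
  \<open>\<pi> - \<theta>\<close>, hence at most \<open>\<pi> - \<theta>\<close>.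
\<close>

lemma arccos_signed_separated_lines:
  assumes "separated_lines m \<epsilon> x" "m \<ge> 2" "i \<in> {1..m}" "j \<in> {1..m}"
    and "u = x i \<or> u = - x i" "v = x j \<or> v = - x j"
    and "i = j \<Longrightarrow> u = v"
  shows "arccos (inner u v) \<le> pi - \<epsilon>"
proof (cases "i = j")
  case True
  have "norm u = 1" using assms by (auto simp: separated_lines_def)
  then have "inner u v = 1" using assms True by (simp add: dot_square_norm)
  moreover have "\<epsilon> \<le> pi"
    using separated_lines_le_pi_half[OF assms(1,2)] pi_gt_zero by linarith
  ultimately show ?thesis by simp
next
  case False
  define q where "q = \<bar>inner (x i) (x j)\<bar>"
  have "norm (x i) = 1" "norm (x j) = 1" using assms by (auto simp: separated_lines_def)
  then have q: "0 \<le> q" "q \<le> 1" using Cauchy_Schwarz_ineq2[of "x i" "x j"] by (auto simp: q_def)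
  have uv: "\<bar>inner u v\<bar> = q" using assms by (auto simp: q_def)
  have "arccos (inner u v) \<le> arccos (- q)"
    using q uv by (intro arccos_le_arccos) auto
  also have "\<dots> = pi - arccos q" using q by (simp add: arccos_minus)
  also have "\<dots> \<le> pi - \<epsilon>" using assms False by (auto simp: separated_lines_def q_def)
  finally show ?thesis .
qed

section \<open>Volumes of pieces of cylinders\<close>

text \<open>
  The product formula is known for Borel sets. A Lebesgue measurable set differs from a Borel set
  by part of a Borel null set \<open>N'\<close>, and \<open>N' \<times> C\<close> is again a null set, even when \<open>C\<close> has infinite
  measure.
\<close>

lemma measure_lebesgue_Times:
  fixes B :: "'a::euclidean_space set" and C :: "'b::euclidean_space set"
  assumes "B \<in> sets lebesgue" "C \<in> sets borel"
  shows "measure lebesgue (B \<times> C) = measure lebesgue B * measure lborel C"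
proof -
  from assms(1) obtain S N N' where SN: "B = S \<union> N" "N \<subseteq> N'" "N' \<in> null_sets lborel"
    "S \<in> sets lborel"
    by (auto simp: sets_completion)
  have times: "emeasure lborel (X \<times> C) = emeasure lborel X * emeasure lborel C"
    if "X \<in> sets lborel" for X :: "'a set"
    unfolding lborel_prod[symmetric] using that assms(2)
    by (intro lborel.emeasure_pair_measure_Times) auto
  have "N' \<times> C \<in> null_sets lborel"
    using SN times[of N'] assms(2) by (auto simp: null_sets_def borel_Times)
  then have null: "N \<times> C \<in> null_sets lebesgue"
    by (rule null_sets_completion_subset[OF Sigma_mono[OF SN(2) subset_refl] null_sets_completionI])
  have nullB: "N \<in> null_sets lebesgue"
    by (rule null_sets_completion_subset[OF SN(2) null_sets_completionI[OF SN(3)]])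
  have SC: "S \<times> C \<in> sets lborel" using SN assms by (auto simp: borel_Times)
  have "emeasure lebesgue (B \<times> C) = emeasure lebesgue (S \<times> C)"
    using SN SC null by (simp add: Sigma_Un_distrib1 emeasure_Un_null_set)
  moreover have "emeasure lebesgue B = emeasure lebesgue S"
    using SN nullB by (simp add: emeasure_Un_null_set)
  ultimately show ?thesis
    using times[OF SN(4)] SN SC by (simp add: measure_def enn2real_mult)
qed

lemma measure_cylinder_halfspace:
  fixes A :: "('a::euclidean_space \<times> real) set"
  assumes "flat_measurable A" "s \<le> t"
  shows "measure lebesgue (cylinder A {s..t} \<inter> halfspace_pos (v, 0)) =
      (t - s) * measure lebesgue ({x. (x, 0) \<in> A} \<inter> halfspace_pos v)" (is ?pos)
    and "measure lebesgue (cylinder A {s..t} \<inter> halfspace_neg (v, 0)) =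
      (t - s) * measure lebesgue ({x. (x, 0) \<in> A} \<inter> halfspace_neg v)" (is ?neg)
proof -
  have main: "measure lebesgue (({x. (x, 0) \<in> A} \<inter> H) \<times> {s..t}) =
      (t - s) * measure lebesgue ({x. (x, 0) \<in> A} \<inter> H)" if "closed H" for H
    using assms that by (subst measure_lebesgue_Times) (auto simp: flat_measurable_def)
  have "closed (halfspace_pos v)" "closed (halfspace_neg v)"
    unfolding halfspace_pos_def halfspace_neg_def
    by (auto intro!: closed_Collect_le continuous_intros)
  note main[OF this(1)] main[OF this(2)]
  moreover have
    "cylinder A {s..t} \<inter> halfspace_pos (v, 0) = ({x. (x, 0) \<in> A} \<inter> halfspace_pos v) \<times> {s..t}"
    "cylinder A {s..t} \<inter> halfspace_neg (v, 0) = ({x. (x, 0) \<in> A} \<inter> halfspace_neg v) \<times> {s..t}"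
    by (auto simp: cylinder_def halfspace_pos_def halfspace_neg_def)
  ultimately show ?pos ?neg by simp_all
qed

section \<open>Equipartition\<close>

theorem theorem10:
  fixes d n :: nat
    and A :: "nat \<Rightarrow> ((real ^ 'm) \<times> real) set"
  assumes "d \<ge> 1" and "n \<ge> 1" and "CARD('m) = d + 1"
    and "\<And>j. j \<in> {1..n} \<Longrightarrow> A j \<subseteq> flat_disc"
    and "\<And>j. j \<in> {1..n} \<Longrightarrow> flat_measurable (A j)"
  shows "\<exists>(k :: nat) (t :: nat \<Rightarrow> real) (p :: nat \<Rightarrow> (real ^ 'm) \<times> real).
    k \<le> n \<and> t 0 = 0 \<and> t (k + 1) = 1 \<and> (\<forall>i\<in>{1..k + 1}. t (i - 1) \<le> t i) \<and>
    (\<forall>i\<in>{1..k + 1}. p i \<in> flat_disc_boundary) \<and>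
    (\<forall>i\<in>{1..k + 1}. \<forall>j\<in>{1..k + 1}.
       arccos (inner (p i) (p j))
         \<le> pi - packing_distance (n + 1) (projective_space :: (real ^ 'm) set set) line_angle) \<and>
    (\<forall>i\<in>{1..k + 1}. \<forall>j\<in>{1..k + 1}. p i \<noteq> - p j) \<and>
    (\<forall>j\<in>{1..n}.
       (\<Sum>i = 1..k + 1. measure lebesgue (cylinder (A j) {t (i - 1)..t i} \<inter> halfspace_pos (p i))) =
       (\<Sum>i = 1..k + 1. measure lebesgue (cylinder (A j) {t (i - 1)..t i} \<inter> halfspace_neg (p i))))"
proof -
  define E where "E = packing_distance (n + 1) (projective_space :: (real ^ 'm) set set) line_angle"
  have m: "n + 1 \<ge> 2" and "DIM(real ^ 'm) \<ge> 2" using assms by auto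
  then obtain x :: "nat \<Rightarrow> real ^ 'm" where x: "separated_lines (n + 1) E x" and "E > 0"
    unfolding E_def using optimal_separated_lines by blast
  define B where "B j = {x. (x, 0) \<in> A j}" for j
  define f where "f j v = measure lebesgue (B j \<inter> halfspace_pos v) -
    measure lebesgue (B j \<inter> halfspace_neg v)" for j and v :: "real ^ 'm"
  have swap: "halfspace_pos (- v) = halfspace_neg v" "halfspace_neg (- v) = halfspace_pos v"
    for v :: "real ^ 'm"
    by (auto simp: halfspace_pos_def halfspace_neg_def)
  have odd: "f j (- v) = - f j v" for j v by (simp add: f_def swap)
  have "card {1..n} < card {1..n + 1}" by simp
  then obtain w q where w: "\<And>i. i \<in> {1..n + 1} \<Longrightarrow> w i \<ge> 0" "(\<Sum>i\<in>{1..n + 1}. w i) = 1"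
    and q: "\<And>i. i \<in> {1..n + 1} \<Longrightarrow> q i = x i \<or> q i = - x i"
    and zero: "\<And>j. j \<in> {1..n} \<Longrightarrow> (\<Sum>i\<in>{1..n + 1}. w i * f j (q i)) = 0"
    using odd
    by (rule odd_functions_common_signed_zero[OF finite_atLeastAtMost finite_atLeastAtMost,
          where f = f and x = x]) (rule that)
  define t where "t i = (\<Sum>l = 1..i. w l)" for i
  have t: "t i - t (i - 1) = w i" if "i \<in> {1..n + 1}" for i
    using that by (cases i) (auto simp: t_def)
  have le: "t (i - 1) \<le> t i" if "i \<in> {1..n + 1}" for i using t[OF that] w(1)[OF that] by linarith
  have norm: "norm (q i) = 1" if "i \<in> {1..n + 1}" for i
    using q[OF that] x by (auto simp: separated_lines_def)
  have angle: "arccos (inner (q i) (q j)) \<le> pi - E"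
    if "i \<in> {1..n + 1}" "j \<in> {1..n + 1}" for i j
    using q that by (intro arccos_signed_separated_lines[OF x m that]) auto
  \<comment> \<open>Antipodal vectors would enclose the angle \<open>\<pi>\<close>, which is excluded by \<open>E > 0\<close>.\<close>
  have antipodal: "q i \<noteq> - q j" if ij: "i \<in> {1..n + 1}" "j \<in> {1..n + 1}" for i j
  proof
    assume "q i = - q j"
    then have "inner (q i) (q j) = -1" using norm ij by (simp add: dot_square_norm)
    then show False using angle[OF ij] \<open>E > 0\<close> by simp
  qed
  have balance:
    "(\<Sum>i = 1..n + 1. measure lebesgue (cylinder (A j) {t (i - 1)..t i} \<inter> halfspace_pos (q i, 0))) =
     (\<Sum>i = 1..n + 1. measure lebesgue (cylinder (A j) {t (i - 1)..t i} \<inter> halfspace_neg (q i, 0)))"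
    (is "?P = ?N") if "j \<in> {1..n}" for j
  proof -
    have "?P - ?N = (\<Sum>i = 1..n + 1. w i * f j (q i))"
      unfolding sum_subtractf[symmetric]
      by (intro sum.cong)
        (simp_all add: measure_cylinder_halfspace[OF assms(5)[OF that] le] t f_def B_def
          right_diff_distrib del: One_nat_def)
    then show ?thesis using zero[OF that] by simp
  qed
  \<comment> \<open>A vanishing weight only yields a slab of height 0, so one may always take \<open>k = n\<close>.\<close>
  show ?thesis
    unfolding E_def[symmetric]
    using w(2) le norm angle antipodal balance
    by (intro exI[of _ n] exI[of _ t] exI[of _ "\<lambda>i. (q i, 0)"])
      (auto simp: t_def flat_disc_boundary_def)
qed

end
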